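(* Assume that $\Omega$ is a nonempty, compact and totally disconnected metric space, with a nested sequence $\mathbf E=\{\mathcal E_n,\ n=0,1,2,\dots\}$ of finite partitions by clopen sets, where $\mathcal E_0=\{\Omega\}$. Suppose $\lim_{n\to\infty}m_n=0$, where $m_n$ is the mesh of $\mathcal E_n$. Assume $\mu$ is a positive finite Borel measure on $\Omega$ with $\mu(E)>0$ for each $n$ and each $E\in\mathcal E_n$. Then the generalized Haar basis $\{\chi_{m,n}\}$ (constructed in the context) is a complete orthonormal basis for $L^2(\mu)$.
   Context: Clopen means both open and closed. A sequence of partitions $\mathbf E=\{\mathcal E_n\}$ is nested if each $\mathcal E_{n+1}$ is a refinement of $\mathcal E_n$, i.e. each set in $\mathcal E_{n+1}$ is a subset of a set in $\mathcal E_n$. The mesh $m_n$ of $\mathcal E_n$ is the maximum of the diameters of the sets in $\mathcal E_n$. $L^2(\mu)$ is the real Hilbert space with inner product $\langle f,g\rangle_\mu=\int fg\,d\mu$; $1_E$ is the characteristic function of $E$. Construction of $\{\chi_{m,n}\}$: start with $\chi_{0,0}=1_\Omega\,\mu(\Omega)^{-1/2}$. Inductively, for each $n\ge 0$ and each $E\in\mathcal E_n$, let $\{E(m),\ m=1,\dots,M\}$ be the partition of $E$ by sets $E(m)\in\mathcal E_{n+1}$. Apply the Gram–Schmidt process in $L^2(\mu)$ to $1_E,1_{E(1)},\dots,1_{E(M-1)}$ to obtain $M$ orthonormal functions; the first is a multiple of $1_E$ and is discarded, and the remaining $M-1$ functions (which lie in the span of the characteristic functions of sets of $\mathcal E_{n+1}$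 and are orthogonal to the span of the characteristic functions of sets of $\mathcal E_n$) are added to the collection as functions $\chi_{m,n+1}$, the index $m$ enumerating all functions so obtained at level $n+1$ as $E$ ranges over $\mathcal E_n$. $\{\chi_{m,n}\}$ is the collection of all functions so obtained, including $\chi_{0,0}$. *)

theory Defs
  imports "HOL-Analysis.Analysis" "HOL-Library.Disjoint_Sets"
begin

definition totally_disconnected :: "'a::topological_space set \<Rightarrow> bool" where
  "totally_disconnected S \<longleftrightarrow> (\<forall>C. C \<subseteq> S \<and> connected C \<longrightarrow> (\<exists>a. C \<subseteq> {a}))"

definition clopen_in :: "'a::topological_space set \<Rightarrow> 'a set \<Rightarrow> bool" where
  "clopen_in S E \<longleftrightarrow> openin (top_of_set S) E \<and> closedin (top_of_set S) E"

definition mesh :: "'a::metric_space set set \<Rightarrow> real" where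
  "mesh P = Max (diameter ` P)"

text \<open>The real space \<open>L\<^sup>2(\<mu>)\<close> is represented by square-integrable functions rather than by classes
  modulo equality almost everywhere; the form below is therefore only a semi-inner product.\<close>

definition L2_space :: "'a measure \<Rightarrow> ('a \<Rightarrow> real) set" where
  "L2_space \<mu> = {f \<in> borel_measurable \<mu>. integrable \<mu> (\<lambda>x. (f x)\<^sup>2)}"

definition L2_inner :: "'a measure \<Rightarrow> ('a \<Rightarrow> real) \<Rightarrow> ('a \<Rightarrow> real) \<Rightarrow> real" where
  "L2_inner \<mu> f g = (\<integral>x. f x * g x \<partial>\<mu>)"

definition L2_norm :: "'a measure \<Rightarrow> ('a \<Rightarrow> real) \<Rightarrow> real" where
  "L2_norm \<mu> f = sqrt (L2_inner \<mu> f f)"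

definition L2_orthonormal :: "'a measure \<Rightarrow> 'i set \<Rightarrow> ('i \<Rightarrow> 'a \<Rightarrow> real) \<Rightarrow> bool" where
  "L2_orthonormal \<mu> I e \<longleftrightarrow> (\<forall>i\<in>I. e i \<in> L2_space \<mu>) \<and>
     (\<forall>i\<in>I. \<forall>j\<in>I. L2_inner \<mu> (e i) (e j) = (if i = j then 1 else 0))"

text \<open>Completeness: the finite linear combinations are dense in \<open>L\<^sup>2(\<mu>)\<close>.\<close>

definition L2_complete_orthonormal_basis ::
    "'a measure \<Rightarrow> 'i set \<Rightarrow> ('i \<Rightarrow> 'a \<Rightarrow> real) \<Rightarrow> bool" where
  "L2_complete_orthonormal_basis \<mu> I e \<longleftrightarrow> L2_orthonormal \<mu> I e \<and>
     (\<forall>f\<in>L2_space \<mu>. \<forall>\<epsilon>>0. \<exists>J c. finite J \<and> J \<subseteq> I \<and>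
        L2_norm \<mu> (\<lambda>x. f x - (\<Sum>i\<in>J. c i * e i x)) < \<epsilon>)"

text \<open>In \<open>gram_schmidt_aux\<close> the first list holds the orthonormal functions produced so far.\<close>

primrec gram_schmidt_aux ::
    "'a measure \<Rightarrow> ('a \<Rightarrow> real) list \<Rightarrow> ('a \<Rightarrow> real) list \<Rightarrow> ('a \<Rightarrow> real) list" where
  "gram_schmidt_aux \<mu> us [] = us"
| "gram_schmidt_aux \<mu> us (v # vs) =
     (let w = (\<lambda>x. v x - (\<Sum>u\<leftarrow>us. L2_inner \<mu> v u * u x))
      in gram_schmidt_aux \<mu> (us @ [\<lambda>x. w x / L2_norm \<mu> w]) vs)"

definition gram_schmidt :: "'a measure \<Rightarrow> ('a \<Rightarrow> real) list \<Rightarrow> ('a \<Rightarrow> real) list" where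
  "gram_schmidt \<mu> vs = gram_schmidt_aux \<mu> [] vs"

text \<open>The functions contributed by a cell \<open>E\<close> that is partitioned as \<open>Fs = [E(1), \<dots>, E(M)]\<close>.\<close>

definition haar_block :: "'a measure \<Rightarrow> 'a set \<Rightarrow> 'a set list \<Rightarrow> ('a \<Rightarrow> real) list" where
  "haar_block \<mu> E Fs = tl (gram_schmidt \<mu> (map indicator (E # butlast Fs)))"

text \<open>\<open>h m n\<close>, for \<open>m \<in> I n\<close>, is a generalized Haar basis of the sequence of partitions \<open>\<E>\<close>. The
  construction involves two choices, and the predicate admits every outcome of both: the order in
  which the sets \<open>E(1), \<dots>, E(M)\<close> are listed (\<open>sub\<close>), and the numbering by \<open>m \<in> I (Suc n)\<close> of the
  functions of level \<open>Suc n\<close>, which arise one for each cell \<open>E\<close> and position \<open>k\<close> in its block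
  (\<open>\<sigma>\<close>).\<close>

definition haar_basis :: "'a set \<Rightarrow> 'a measure \<Rightarrow> (nat \<Rightarrow> 'a set set) \<Rightarrow>
    (nat \<Rightarrow> nat set) \<Rightarrow> (nat \<Rightarrow> nat \<Rightarrow> 'a \<Rightarrow> real) \<Rightarrow> bool" where
  "haar_basis \<Omega> \<mu> \<E> I h \<longleftrightarrow>
     I 0 = {0} \<and> h 0 0 = (\<lambda>x. indicator \<Omega> x * measure \<mu> \<Omega> powr (- 1 / 2)) \<and>
     (\<exists>sub.
        (\<forall>n. \<forall>E\<in>\<E> n. distinct (sub n E) \<and> set (sub n E) = {F \<in> \<E> (Suc n). F \<subseteq> E}) \<and>
        (\<forall>n. \<exists>\<sigma>.
           bij_betw \<sigma> (I (Suc n)) (SIGMA E : \<E> n. {..<length (haar_block \<mu> E (sub n E))}) \<and>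
           (\<forall>m\<in>I (Suc n). h m (Suc n) =
              (case \<sigma> m of (E, k) \<Rightarrow> haar_block \<mu> E (sub n E) ! k))))"

end

theory Submission
  imports Defs "HOL-Library.Function_Algebras"
begin

text \<open>A Haar function of level \<open>n + 1\<close> lives on a single cell of \<open>\<E> n\<close> and is orthogonal to its
  indicator, hence to every function constant on the cells of \<open>\<E> n\<close>, in particular to all Haar
  functions of lower level; different cells of the same level give disjoint supports. Conversely,
  the indicator of a cell together with its block spans the indicators of its subcells, so by
  induction all cell indicators are combinations of Haar functions. As the meshes tend to zero,
  every relatively open set is a countable union of cells, so the cells, closed under intersection
  up to the empty set, generate the Borel sets; a Dynkin class argument then puts all indicators of
  Borel sets, and by dominated convergence all of \<open>L\<^sup>2\<close>, into the closure of the span.\<close>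

section \<open>Linear combinations of functions\<close>

text \<open>A named scaling lets the locale \<open>vector_space\<close> be interpreted for real
  functions on any type, which supplies \<open>span\<close> and \<open>subspace\<close>. Addition is
  the pointwise one of the imported function algebra.\<close>

definition fun_scale :: "real \<Rightarrow> ('a \<Rightarrow> real) \<Rightarrow> 'a \<Rightarrow> real" where
  "fun_scale c f = (\<lambda>x. c * f x)"

interpretation fun_space: vector_space "fun_scale :: real \<Rightarrow> ('a \<Rightarrow> real) \<Rightarrow> 'a \<Rightarrow> real"
  by unfold_locales (auto simp: fun_scale_def fun_eq_iff algebra_simps)

lemma sum_fun_scale: "(\<Sum>i\<in>J. fun_scale (c i) (f i)) = (\<lambda>x. \<Sum>i\<in>J. c i * f i x)"
  by (induction J rule: infinite_finite_induct) (auto simp: fun_scale_def fun_eq_iff)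

text \<open>This lemma and the next ones translate between the operations on functions and pointwise
  lambda terms, the form in which \<open>L2_inner\<close>, \<open>L2_norm\<close> and the
  Gram-Schmidt process are written.\<close>

lemma subspace_funI:
  assumes "(\<lambda>x. 0) \<in> V"
    and "\<And>f g. f \<in> V \<Longrightarrow> g \<in> V \<Longrightarrow> (\<lambda>x. f x + g x) \<in> V"
    and "\<And>c f. f \<in> V \<Longrightarrow> (\<lambda>x. c * f x) \<in> V"
  shows "fun_space.subspace V"
  using assms by (auto simp: fun_space.subspace_def fun_scale_def plus_fun_def zero_fun_def)

lemma subspace_fun_zero: "fun_space.subspace V \<Longrightarrow> (\<lambda>x. 0) \<in> V"
  using fun_space.subspace_0[of V] by (simp add: zero_fun_def)

lemma subspace_fun_add:
  "fun_space.subspace V \<Longrightarrow> f \<in> V \<Longrightarrow> g \<in> V \<Longrightarrow> (\<lambda>x. f x + g x) \<in> V"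
  using fun_space.subspace_add[of V f g] by (simp add: plus_fun_def)

lemma subspace_fun_scale: "fun_space.subspace V \<Longrightarrow> f \<in> V \<Longrightarrow> (\<lambda>x. c * f x) \<in> V"
  using fun_space.subspace_scale[of V f c] by (simp add: fun_scale_def)

lemma subspace_fun_diff:
  assumes "fun_space.subspace V" "f \<in> V" "g \<in> V"
  shows "(\<lambda>x. f x - g x) \<in> V"
  using subspace_fun_add[OF assms(1,2) subspace_fun_scale[OF assms(1,3), of "-1"]] by simp

lemma subspace_fun_sum:
  assumes "fun_space.subspace V" "\<And>i. i \<in> J \<Longrightarrow> f i \<in> V"
  shows "(\<lambda>x. \<Sum>i\<in>J. c i * f i x) \<in> V"
proof -
  have "(\<Sum>i\<in>J. fun_scale (c i) (f i)) \<in> V"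
    by (intro fun_space.subspace_sum fun_space.subspace_scale assms)
  then show ?thesis by (simp add: sum_fun_scale)
qed

text \<open>A span element is a priori a sum over a set of functions, whereas completeness asks for
  a sum over indices. Choosing one index for each function that occurs converts the former into the
  latter even if \<open>e\<close> is not injective.\<close>

lemma span_image_explicit:
  assumes "g \<in> fun_space.span (e ` I)"
  obtains J c where "finite J" "J \<subseteq> I" "g = (\<lambda>x. \<Sum>i\<in>J. c i * e i x)"
proof -
  obtain t r where t: "finite t" "t \<subseteq> e ` I" and g: "g = (\<Sum>a\<in>t. fun_scale (r a) a)"
    using assms unfolding fun_space.span_explicit by auto
  obtain J where J: "J \<subseteq> I" "inj_on e J" "t = e ` J"
    using t(2) by (meson subset_image_inj)
  have "finite J" using t J finite_imageD by blast
  moreover have "g = (\<lambda>x. \<Sum>i\<in>J. r (e i) * e i x)"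
    unfolding g J(3) by (simp add: sum.reindex[OF J(2)] sum_fun_scale)
  ultimately show ?thesis by (rule that[OF _ J(1)])
qed

section \<open>The semi-inner product\<close>

text \<open>The bound |ab| \<le> a^2 + b^2 dominates the product by an integrable function; no
  Cauchy-Schwarz inequality is involved.\<close>

lemma L2_integrable_mult:
  assumes "f \<in> L2_space M" "g \<in> L2_space M"
  shows "integrable M (\<lambda>x. f x * g x)"
proof (rule Bochner_Integration.integrable_bound)
  show "integrable M (\<lambda>x. (f x)\<^sup>2 + (g x)\<^sup>2)"
    and "(\<lambda>x. f x * g x) \<in> borel_measurable M"
    using assms by (auto simp: L2_space_def)
  have "\<bar>a * b\<bar> \<le> a\<^sup>2 + b\<^sup>2" for a b :: real
    using sum_squares_bound[of "\<bar>a\<bar>" "\<bar>b\<bar>"] abs_ge_zero[of "a * b"]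
    unfolding abs_mult power2_abs by linarith
  then show "AE x in M. norm (f x * g x) \<le> norm ((f x)\<^sup>2 + (g x)\<^sup>2)"
    by (auto simp: abs_of_nonneg)
qed

lemma subspace_L2_space: "fun_space.subspace (L2_space M)"
proof (rule subspace_funI)
  fix f g assume f: "f \<in> L2_space M" and g: "g \<in> L2_space M"
  have "integrable M (\<lambda>x. (f x)\<^sup>2 + (g x)\<^sup>2 + 2 * (f x * g x))"
    using L2_integrable_mult[OF f g] f g by (auto simp: L2_space_def)
  then show "(\<lambda>x. f x + g x) \<in> L2_space M"
    using f g by (auto simp: L2_space_def power2_sum algebra_simps)
qed (auto simp: L2_space_def power_mult_distrib)

lemma L2_inner_commute: "L2_inner M f g = L2_inner M g f"
  by (simp add: L2_inner_def mult.commute)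

lemma L2_inner_add_right:
  "f \<in> L2_space M \<Longrightarrow> g \<in> L2_space M \<Longrightarrow> h \<in> L2_space M \<Longrightarrow>
    L2_inner M f (\<lambda>x. g x + h x) = L2_inner M f g + L2_inner M f h"
  by (simp add: L2_inner_def L2_integrable_mult distrib_left)

lemma L2_inner_diff_right:
  "f \<in> L2_space M \<Longrightarrow> g \<in> L2_space M \<Longrightarrow> h \<in> L2_space M \<Longrightarrow>
    L2_inner M f (\<lambda>x. g x - h x) = L2_inner M f g - L2_inner M f h"
  by (simp add: L2_inner_def L2_integrable_mult right_diff_distrib)

lemma L2_inner_scale_right: "L2_inner M f (\<lambda>x. c * g x) = c * L2_inner M f g"
  by (simp add: L2_inner_def mult.left_commute)

lemma L2_inner_sum_right:
  assumes "f \<in> L2_space M" "\<And>i. i \<in> J \<Longrightarrow> g i \<in> L2_space M"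
  shows "L2_inner M f (\<lambda>x. \<Sum>i\<in>J. c i * g i x) = (\<Sum>i\<in>J. c i * L2_inner M f (g i))"
proof -
  have "f x * (\<Sum>i\<in>J. c i * g i x) = (\<Sum>i\<in>J. c i * (f x * g i x))" for x
    by (simp add: sum_distrib_left mult_ac)
  then show ?thesis
    unfolding L2_inner_def using assms by (simp add: L2_integrable_mult)
qed

lemma L2_inner_self: "L2_inner M f f = (\<integral>x. (f x)\<^sup>2 \<partial>M)"
  by (simp add: L2_inner_def power2_eq_square)

lemma L2_inner_self_nonneg: "L2_inner M f f \<ge> 0"
  by (simp add: L2_inner_self)

text \<open>Phrasing orthogonality to \<open>f\<close> as a subspace lets minimality of the span
  reduce it to a check on generators.\<close>

lemma subspace_L2_orthogonal:
  assumes "f \<in> L2_space M"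
  shows "fun_space.subspace {g \<in> L2_space M. L2_inner M f g = 0}"
proof (rule subspace_funI)
  show "(\<lambda>x. 0) \<in> {g \<in> L2_space M. L2_inner M f g = 0}"
    using subspace_fun_zero[OF subspace_L2_space, of M] by (simp add: L2_inner_def)
qed (use assms in \<open>simp_all add: L2_inner_add_right L2_inner_scale_right
    subspace_fun_add[OF subspace_L2_space] subspace_fun_scale[OF subspace_L2_space]\<close>)

lemma L2_orthogonal_span:
  assumes "f \<in> L2_space M" "g \<in> fun_space.span S"
    and "\<And>v. v \<in> S \<Longrightarrow> v \<in> L2_space M \<and> L2_inner M f v = 0"
  shows "L2_inner M f g = 0"
  using fun_space.span_minimal[OF _ subspace_L2_orthogonal[OF assms(1)], of S] assms by auto

lemma L2_inner_add_self_le: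
  assumes "f \<in> L2_space M" "g \<in> L2_space M"
  shows "L2_inner M (\<lambda>x. f x + g x) (\<lambda>x. f x + g x) \<le> 2 * L2_inner M f f + 2 * L2_inner M g g"
proof -
  have "(\<integral>x. (f x + g x)\<^sup>2 \<partial>M) \<le> (\<integral>x. 2 * (f x)\<^sup>2 + 2 * (g x)\<^sup>2 \<partial>M)"
  proof (rule integral_mono)
    show "integrable M (\<lambda>x. (f x + g x)\<^sup>2)"
      using subspace_fun_add[OF subspace_L2_space assms] by (simp add: L2_space_def)
    show "(f x + g x)\<^sup>2 \<le> 2 * (f x)\<^sup>2 + 2 * (g x)\<^sup>2" for x
      using sum_squares_bound[of "f x" "g x"] by (simp add: power2_sum)
  qed (use assms in \<open>auto simp: L2_space_def\<close>)
  then show ?thesis using assms by (simp add: L2_inner_self L2_space_def)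
qed

lemma (in finite_measure) indicator_L2_space:
  assumes "A \<in> sets M"
  shows "indicator A \<in> L2_space M"
proof -
  have "(\<lambda>x. (indicator A x :: real)\<^sup>2) = indicator A"
    by (auto simp: fun_eq_iff indicator_def)
  then show ?thesis
    using assms by (auto simp: L2_space_def emeasure_eq_measure)
qed

text \<open>A vanishing seminorm only gives \<open>f = 0\<close> almost everywhere. A set of
  positive measure cannot avoid the zeros of \<open>f\<close>, so pointwise information can still be
  extracted.\<close>

lemma L2_norm_zeroD:
  assumes "f \<in> L2_space M" "L2_norm M f = 0" "A \<in> sets M" "measure M A > 0"
  shows "\<exists>x\<in>A. f x = 0"
proof (rule ccontr)
  assume "\<not> ?thesis"
  then have *: "\<And>x. x \<in> A \<Longrightarrow> f x \<noteq> 0" by auto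
  have "(\<integral>x. (f x)\<^sup>2 \<partial>M) = 0"
    using assms(2) by (simp add: L2_norm_def L2_inner_self)
  then have "AE x in M. (f x)\<^sup>2 = 0"
    using assms(1) by (subst (asm) integral_nonneg_eq_0_iff_AE) (auto simp: L2_space_def)
  then have "AE x in M. x \<notin> A"
    by eventually_elim (use * in auto)
  then have "emeasure M A = 0"
    using assms(3) AE_iff_null_sets[of A M] by (auto simp: null_sets_def)
  then show False using assms(4) by (simp add: measure_def)
qed

section \<open>The Gram--Schmidt process\<close>

text \<open>Subtracting the projection makes \<open>w\<close> orthogonal to \<open>us\<close>, and
  dividing by the norm makes it a unit vector. The condition \<open>nz\<close> excludes division by
  zero, whose default value would turn \<open>u'\<close> into the zero function. The spans agree
  because each of \<open>v\<close> and \<open>u'\<close> is a combination of the other and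
  \<open>us\<close>.\<close>

lemma gram_schmidt_step:
  assumes us: "L2_orthonormal M {..<length us} ((!) us)"
    and v: "v \<in> L2_space M" and w: "w = (\<lambda>x. v x - (\<Sum>u\<leftarrow>us. L2_inner M v u * u x))"
    and nz: "L2_norm M w \<noteq> 0" and u': "u' = (\<lambda>x. w x / L2_norm M w)"
  shows "L2_orthonormal M {..<length (us @ [u'])} ((!) (us @ [u']))"
    and "fun_space.span (insert u' (set us)) = fun_space.span (insert v (set us))"
proof -
  define p where "p = (\<lambda>x. \<Sum>u\<leftarrow>us. L2_inner M v u * u x)"
  have p_sum: "p = (\<lambda>x. \<Sum>i\<in>{..<length us}. L2_inner M v (us ! i) * (us ! i) x)"
    by (simp add: p_def sum_list_sum_nth atLeast0LessThan)
  have p_span: "p \<in> fun_space.span (set us)"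
    unfolding p_sum
    by (intro subspace_fun_sum fun_space.subspace_span fun_space.span_base) auto
  have usL2: "us ! i \<in> L2_space M" if "i < length us" for i
    using us that by (auto simp: L2_orthonormal_def)
  have inner_us: "L2_inner M (us ! i) (us ! j) = (if i = j then 1 else 0)"
    if "i < length us" "j < length us" for i j
    using us that by (auto simp: L2_orthonormal_def)
  have pL2: "p \<in> L2_space M"
    unfolding p_sum by (intro subspace_fun_sum subspace_L2_space usL2) auto
  have w_p: "w = (\<lambda>x. v x - p x)" by (simp add: w p_def)
  have wL2: "w \<in> L2_space M"
    unfolding w_p by (rule subspace_fun_diff[OF subspace_L2_space v pL2])
  have u'_scale: "u' = (\<lambda>x. (1 / L2_norm M w) * w x)" by (simp add: u')
  have u'L2: "u' \<in> L2_space M"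
    unfolding u'_scale by (rule subspace_fun_scale[OF subspace_L2_space wL2])
  have "L2_inner M (us ! j) w = 0" if j: "j < length us" for j
  proof -
    have "L2_inner M (us ! j) p = (\<Sum>i<length us. L2_inner M v (us ! i) * (if j = i then 1 else 0))"
      unfolding p_sum using j by (subst L2_inner_sum_right) (auto simp: usL2 inner_us)
    also have "\<dots> = L2_inner M (us ! j) v"
      using j by (simp add: L2_inner_commute if_distrib cong: if_cong)
    finally show ?thesis
      unfolding w_p using L2_inner_diff_right[OF usL2[OF j] v pL2] by simp
  qed
  then have orth: "L2_inner M (us ! j) u' = 0" if "j < length us" for j
    unfolding u'_scale L2_inner_scale_right using that by simp
  have "L2_inner M w w = (L2_norm M w)\<^sup>2"
    by (simp add: L2_norm_def L2_inner_self_nonneg)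
  moreover have "L2_inner M u' u' = (1 / L2_norm M w) * ((1 / L2_norm M w) * L2_inner M w w)"
    unfolding u' L2_inner_def by (simp flip: integral_mult_right_zero)
  ultimately have unit: "L2_inner M u' u' = 1"
    using nz by (simp add: power2_eq_square)
  show "L2_orthonormal M {..<length (us @ [u'])} ((!) (us @ [u']))"
    using orth unit u'L2 usL2 inner_us
    by (auto simp: L2_orthonormal_def nth_append less_Suc_eq L2_inner_commute[of M u' "us ! _"])
  have sub: "fun_space.span (set us) \<subseteq> fun_space.span (insert a (set us))"
    and base: "a \<in> fun_space.span (insert a (set us))" for a
    by (rule fun_space.span_mono, blast) (rule fun_space.span_base, blast)
  have "w \<in> fun_space.span (insert v (set us))"
    unfolding w_p
    using p_span sub by (intro subspace_fun_diff[OF fun_space.subspace_span base]) blast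
  then have u'_in: "u' \<in> fun_space.span (insert v (set us))"
    unfolding u'_scale by (rule subspace_fun_scale[OF fun_space.subspace_span])
  \<comment> \<open>The definition of \<open>u'\<close> solved for \<open>v\<close>.\<close>
  have "(\<lambda>x. L2_norm M w * u' x + p x) \<in> fun_space.span (insert u' (set us))"
    using p_span sub
    by (intro subspace_fun_add[OF fun_space.subspace_span
          subspace_fun_scale[OF fun_space.subspace_span base]]) blast
  moreover have "(\<lambda>x. L2_norm M w * u' x + p x) = v"
    using nz by (auto simp: u' w_p)
  ultimately have v_in: "v \<in> fun_space.span (insert u' (set us))"
    by (rule subst[rotated])
  show "fun_space.span (insert u' (set us)) = fun_space.span (insert v (set us))"
    unfolding fun_space.span_eq
    using u'_in v_in fun_space.span_superset[of "insert u' (set us)"]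
      fun_space.span_superset[of "insert v (set us)"] by auto
qed

lemma span_Un_cong:
  "fun_space.span A = fun_space.span B \<Longrightarrow> fun_space.span (A \<union> C) = fun_space.span (B \<union> C)"
  by (simp add: fun_space.span_Un)

text \<open>The third hypothesis is linear independence modulo null functions: no vector of
  \<open>vs\<close> has seminorm distance zero from a combination of its predecessors. The form
  \<open>us @ ws\<close> of the result keeps the initial functions identifiable, so that they can be
  discarded later.\<close>

lemma gram_schmidt_aux_correct:
  assumes "L2_orthonormal M {..<length us} ((!) us)" and "set vs \<subseteq> L2_space M"
    and "\<And>k g. k < length vs \<Longrightarrow> g \<in> fun_space.span (set us \<union> set (take k vs)) \<Longrightarrow>
      L2_norm M (\<lambda>x. (vs ! k) x - g x) \<noteq> 0"
  shows "\<exists>ws. gram_schmidt_aux M us vs = us @ ws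
    \<and> L2_orthonormal M {..<length (us @ ws)} ((!) (us @ ws))
    \<and> fun_space.span (set (us @ ws)) = fun_space.span (set us \<union> set vs)"
  using assms
proof (induction vs arbitrary: us)
  case Nil
  then show ?case by simp
next
  case (Cons v vs)
  define w where "w = (\<lambda>x. v x - (\<Sum>u\<leftarrow>us. L2_inner M v u * u x))"
  define u' where "u' = (\<lambda>x. w x / L2_norm M w)"
  have v: "v \<in> L2_space M" using Cons.prems by simp
  have "(\<lambda>x. \<Sum>u\<leftarrow>us. L2_inner M v u * u x) \<in> fun_space.span (set us)"
    unfolding sum_list_sum_nth length_map
    using subspace_fun_sum[OF fun_space.subspace_span[of "set us"], of "{0..<length us}" "(!) us"
        "\<lambda>i. L2_inner M v (us ! i)"] by (simp add: fun_space.span_base)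
  then have nz: "L2_norm M w \<noteq> 0"
    using Cons.prems(3)[of 0] by (simp add: w_def)
  note step = gram_schmidt_step[OF Cons.prems(1) v w_def nz u'_def]
  have span: "fun_space.span (set (us @ [u']) \<union> X) = fun_space.span (set us \<union> insert v X)" for X
    using span_Un_cong[OF step(2), of X] by (simp add: insert_commute)
  have "\<exists>ws. gram_schmidt_aux M (us @ [u']) vs = (us @ [u']) @ ws
    \<and> L2_orthonormal M {..<length ((us @ [u']) @ ws)} ((!) ((us @ [u']) @ ws))
    \<and> fun_space.span (set ((us @ [u']) @ ws)) = fun_space.span (set (us @ [u']) \<union> set vs)"
  proof (rule Cons.IH[OF step(1)])
    show "set vs \<subseteq> L2_space M" using Cons.prems by simp
    \<comment> \<open>Position \<open>k\<close> of \<open>vs\<close> is position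
      \<open>Suc k\<close> of \<open>v # vs\<close>, and \<open>span\<close> replaces the new
      function \<open>u'\<close> by \<open>v\<close>, so the independence hypothesis carries
      over.\<close>
    fix k g assume "k < length vs" "g \<in> fun_space.span (set (us @ [u']) \<union> set (take k vs))"
    then show "L2_norm M (\<lambda>x. (vs ! k) x - g x) \<noteq> 0"
      using Cons.prems(3)[of "Suc k" g] unfolding span by simp
  qed
  then obtain ws where ws: "gram_schmidt_aux M (us @ [u']) vs = (us @ [u']) @ ws"
    "L2_orthonormal M {..<length ((us @ [u']) @ ws)} ((!) ((us @ [u']) @ ws))"
    "fun_space.span (set ((us @ [u']) @ ws)) = fun_space.span (set (us @ [u']) \<union> set vs)"
    by blast
  show ?case
    using ws unfolding span
    by (intro exI[of _ "u' # ws"]) (simp add: Let_def w_def u'_def)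
qed

section \<open>Indicators of disjoint sets and the Haar block of a single cell\<close>

lemma indicator_eq_sum_disjoint:
  assumes "finite \<F>" "disjoint \<F>"
  shows "(indicator (\<Union>\<F>) :: 'a \<Rightarrow> real) = (\<lambda>x. \<Sum>F\<in>\<F>. 1 * indicator F x)"
  using indicator_UN_disjoint[of \<F> "\<lambda>F. F"] assms
  by (auto simp: disjoint_family_on_def disjoint_def fun_eq_iff)

lemma indicator_Union_in_span:
  assumes "finite \<F>" "disjoint \<F>"
  shows "indicator (\<Union>\<F>) \<in> fun_space.span (indicator ` \<F> :: ('a \<Rightarrow> real) set)"
  unfolding indicator_eq_sum_disjoint[OF assms]
  by (intro subspace_fun_sum fun_space.subspace_span fun_space.span_base imageI)

context finite_measure
begin

text \<open>This is the independence required by Gram-Schmidt, and the reason for leaving out the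
  last subcell: \<open>F\<close> and the last subcell \<open>L\<close> are not separated by any of
  the earlier functions, but they are separated by the indicator of \<open>F\<close>.\<close>

lemma indicator_independent:
  assumes dist: "distinct Fs" and ne: "Fs \<noteq> []" and disj: "disjoint (set Fs)"
    and E: "\<Union> (set Fs) = E"
    and pos: "\<And>F. F \<in> set Fs \<Longrightarrow> F \<in> sets M \<and> measure M F > 0"
    and k: "k < length (butlast Fs)"
    and g: "g \<in> fun_space.span (insert (indicator E) (indicator ` set (take k (butlast Fs))))"
  shows "L2_norm M (\<lambda>x. indicator (Fs ! k) x - g x) \<noteq> 0"
proof
  assume zero: "L2_norm M (\<lambda>x. indicator (Fs ! k) x - g x) = 0"
  define F where "F = Fs ! k"
  define L where "L = last Fs"
  have Fs: "F \<in> set Fs" "L \<in> set Fs"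
    using k ne by (auto simp: F_def L_def)
  have L_nth: "L = Fs ! (length Fs - 1)"
    using ne by (simp add: L_def last_conv_nth)
  have "F \<noteq> L"
    using dist ne k by (auto simp: F_def L_nth nth_eq_iff_index_eq)
  then have FL: "F \<inter> L = {}"
    using disj Fs by (auto simp: disjoint_def)
  have sub_E: "F \<subseteq> E" "L \<subseteq> E" using Fs E by auto
  have *: "G \<inter> (F \<union> L) = {}" if G: "G \<in> set (take k (butlast Fs))" for G
  proof -
    obtain i where i: "i < k" "G = Fs ! i"
      using G k by (auto simp: in_set_conv_nth nth_butlast)
    then have "G \<in> set Fs" "G \<noteq> F" "G \<noteq> L"
      using dist k by (auto simp: F_def L_nth nth_eq_iff_index_eq)
    then show ?thesis using disj Fs by (auto simp: disjoint_def)
  qed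
  \<comment> \<open>\<open>g\<close> is constant on \<open>F \<union> L\<close>, unlike the indicator of \<open>F\<close>\<close>
  let ?C = "{f :: 'a \<Rightarrow> real. \<exists>c. \<forall>x\<in>F \<union> L. f x = c}"
  have "fun_space.subspace ?C"
    by (rule subspace_funI; clarsimp; metis)
  moreover have "indicator E \<in> ?C"
    using sub_E by (intro CollectI exI[of _ 1]) auto
  moreover have "indicator G \<in> ?C" if "G \<in> set (take k (butlast Fs))" for G
    using *[OF that] by (intro CollectI exI[of _ 0]) (auto simp: indicator_def)
  ultimately have "g \<in> ?C"
    using fun_space.span_minimal[of "insert (indicator E) (indicator ` set (take k (butlast Fs)))" ?C] g
    by auto
  then obtain c where c: "\<And>x. x \<in> F \<union> L \<Longrightarrow> g x = c" by blast
  have gL2: "g \<in> L2_space M"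
  proof -
    have "E \<in> sets M"
      unfolding E[symmetric] using pos by (intro sets.finite_Union) auto
    moreover have "G \<in> sets M" if "G \<in> set (take k (butlast Fs))" for G
      using that pos by (meson in_set_butlastD in_set_takeD)
    ultimately have "insert (indicator E) (indicator ` set (take k (butlast Fs))) \<subseteq> L2_space M"
      by (auto intro: indicator_L2_space)
    then show ?thesis
      using g fun_space.span_minimal subspace_L2_space by blast
  qed
  have d: "(\<lambda>x. indicator F x - g x) \<in> L2_space M"
    using pos Fs by (intro subspace_fun_diff subspace_L2_space gL2 indicator_L2_space) auto
  \<comment> \<open>Both sets have positive measure, so the difference has a zero in each. The zero
    in \<open>F\<close> forces \<open>c = 1\<close>, the one in \<open>L\<close> forces
    \<open>c = 0\<close>.\<close>
  have "\<exists>x\<in>F. indicator F x - g x = 0" "\<exists>x\<in>L. indicator F x - g x = 0"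
    using L2_norm_zeroD[OF d zero[folded F_def]] pos Fs by blast+
  then show False
    using c FL by (auto simp: indicator_def)
qed

text \<open>The discarded first function is a multiple of the indicator of \<open>E\<close>.
  Everything after it is therefore orthogonal to that indicator, and adding the indicator back
  restores the full Gram-Schmidt span.\<close>

lemma haar_block_correct:
  assumes dist: "distinct Fs" and ne: "Fs \<noteq> []" and disj: "disjoint (set Fs)"
    and E: "\<Union> (set Fs) = E"
    and pos: "\<And>F. F \<in> set Fs \<Longrightarrow> F \<in> sets M \<and> measure M F > 0"
  shows "L2_orthonormal M {..<length (haar_block M E Fs)} ((!) (haar_block M E Fs))"
    and "set (haar_block M E Fs) \<subseteq> fun_space.span (indicator ` set Fs)"
    and "f \<in> set (haar_block M E Fs) \<Longrightarrow> L2_inner M (indicator E) f = 0"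
    and "indicator ` set Fs \<subseteq> fun_space.span (insert (indicator E) (set (haar_block M E Fs)))"
proof -
  let ?b = "haar_block M E Fs"
  define rest :: "('a \<Rightarrow> real) list" where "rest = map indicator (butlast Fs)"
  define u :: "'a \<Rightarrow> real" where "u = (\<lambda>x. indicator E x / L2_norm M (indicator E))"
  have EM: "E \<in> sets M"
    unfolding E[symmetric] using pos by (intro sets.finite_Union) auto
  have EL2: "indicator E \<in> L2_space M" using EM by (rule indicator_L2_space)
  have "hd Fs \<subseteq> E" "hd Fs \<in> set Fs"
    using E ne by auto
  then have "measure M E > 0"
    using pos EM finite_measure_mono[of "hd Fs" E] by fastforce
  then have nz: "L2_norm M (indicator E) \<noteq> 0"
    using L2_norm_zeroD[OF EL2 _ EM] by auto
  \<comment> \<open>The first Gram-Schmidt step, from the empty list, is carried out separately; its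
    result \<open>u\<close> is the function that \<open>tl\<close> removes.\<close>
  have u_on: "L2_orthonormal M {..<length [u]} ((!) [u])"
    and span_u: "fun_space.span {u} = fun_space.span {indicator E}"
    using gram_schmidt_step[OF _ EL2 _ nz u_def, of "[]"] by (simp_all add: L2_orthonormal_def)
  have span_uX: "fun_space.span (insert u X) = fun_space.span (insert (indicator E) X)" for X
    using span_Un_cong[OF span_u, of X] by simp
  have rest: "set rest = indicator ` set (butlast Fs)" by (simp add: rest_def)
  have restL2: "set rest \<subseteq> L2_space M"
    unfolding rest using pos by (auto intro: indicator_L2_space dest: in_set_butlastD)
  obtain ws where ws: "gram_schmidt_aux M [u] rest = [u] @ ws
    \<and> L2_orthonormal M {..<length ([u] @ ws)} ((!) ([u] @ ws))
    \<and> fun_space.span (set ([u] @ ws)) = fun_space.span (set [u] \<union> set rest)"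
  proof (rule exE[OF gram_schmidt_aux_correct[OF u_on restL2]])
    fix k g assume k: "k < length rest" and g: "g \<in> fun_space.span (set [u] \<union> set (take k rest))"
    have "g \<in> fun_space.span (insert (indicator E) (indicator ` set (take k (butlast Fs))))"
      using g by (simp add: span_uX rest_def take_map)
    then show "L2_norm M (\<lambda>x. (rest ! k) x - g x) \<noteq> 0"
      using indicator_independent[OF assms(1-4), of k g] pos k by (simp add: rest_def nth_butlast)
  qed
  have "?b = tl (gram_schmidt_aux M [u] rest)"
    by (simp add: haar_block_def gram_schmidt_def u_def Let_def rest_def)
  then have b: "?b = ws" using ws by simp
  have on: "L2_orthonormal M {..<length (u # ?b)} ((!) (u # ?b))"
    and span_b: "fun_space.span (insert u (set ?b)) = fun_space.span (insert u (set rest))"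
    using ws unfolding b by simp_all
  \<comment> \<open>Index 0 stands for \<open>u\<close>, and \<open>Suc i\<close> for position
    \<open>i\<close> of the block.\<close>
  have on_b: "L2_inner M ((u # ?b) ! i) ((u # ?b) ! j) = (if i = j then 1 else 0)"
    "(u # ?b) ! i \<in> L2_space M"
    if "i < Suc (length ?b)" "j < Suc (length ?b)" for i j
    using on that by (auto simp: L2_orthonormal_def)
  show "L2_orthonormal M {..<length ?b} ((!) ?b)"
    unfolding L2_orthonormal_def using on_b[of "Suc _" "Suc _"] by auto
  have E_in: "indicator E \<in> fun_space.span (indicator ` set Fs :: ('a \<Rightarrow> real) set)"
    using indicator_Union_in_span[of "set Fs"] disj E by simp
  have "insert (indicator E) (set rest) \<subseteq> fun_space.span (indicator ` set Fs)"
    unfolding rest using E_in fun_space.span_superset[of "indicator ` set Fs"]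
    by (blast dest: in_set_butlastD)
  then have "fun_space.span (insert (indicator E) (set rest))
      \<subseteq> fun_space.span (indicator ` set Fs)"
    by (intro fun_space.span_minimal fun_space.subspace_span)
  then show "set ?b \<subseteq> fun_space.span (indicator ` set Fs)"
    using span_b fun_space.span_superset[of "insert u (set ?b)"] by (auto simp: span_uX)
  show "L2_inner M (indicator E) f = 0" if "f \<in> set ?b"
  proof -
    obtain i where i: "i < length ?b" "f = ?b ! i"
      using \<open>f \<in> set ?b\<close> by (auto simp: in_set_conv_nth)
    then have "L2_inner M f u = 0"
      using on_b(1)[of "Suc i" 0] by simp
    \<comment> \<open>Multiplying by the norm undoes the normalisation and passes from
      \<open>u\<close> back to the indicator of \<open>E\<close>.\<close>
    then have "L2_norm M (indicator E) * L2_inner M f u = 0" by simp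
    then have "L2_inner M f (\<lambda>x. L2_norm M (indicator E) * u x) = 0"
      by (simp only: L2_inner_scale_right)
    then show ?thesis
      using nz by (simp add: u_def L2_inner_commute)
  qed
  let ?S = "fun_space.span (insert (indicator E) (set ?b))"
  have span: "?S = fun_space.span (insert (indicator E) (set rest))"
    using span_b by (simp add: span_uX)
  have butlast_in: "indicator F \<in> ?S" if "F \<in> set (butlast Fs)" for F
    using that unfolding span rest by (intro fun_space.span_base) auto
  have Fs_eq: "set Fs = insert (last Fs) (set (butlast Fs))" "last Fs \<notin> set (butlast Fs)"
  proof -
    have "Fs = butlast Fs @ [last Fs]" using ne by simp
    then show "set Fs = insert (last Fs) (set (butlast Fs))" "last Fs \<notin> set (butlast Fs)"
      using dist by (metis list.set(1) list.set(2) set_append Un_insert_right Un_empty_right,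
          metis distinct_append disjoint_insert(1) list.set(2))
  qed
  \<comment> \<open>The last subcell was never fed to Gram-Schmidt; its indicator is recovered by
    subtracting those of all other subcells from that of \<open>E\<close>. The factor 1 matches the
    shape of \<open>subspace_fun_sum\<close>.\<close>
  have "(\<lambda>x. indicator E x - (\<Sum>F\<in>set (butlast Fs). 1 * indicator F x)) \<in> ?S"
    by (intro subspace_fun_diff subspace_fun_sum fun_space.subspace_span)
      (simp_all add: butlast_in fun_space.span_base)
  moreover have "(\<lambda>x. indicator E x - (\<Sum>F\<in>set (butlast Fs). 1 * indicator F x :: real))
      = indicator (last Fs)"
    unfolding E[symmetric] indicator_eq_sum_disjoint[OF finite_set disj]
    using Fs_eq by (simp add: fun_eq_iff)
  ultimately have "indicator (last Fs) \<in> ?S" by simp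
  then show "indicator ` set Fs \<subseteq> ?S"
    using butlast_in unfolding Fs_eq(1) by auto
qed

end

section \<open>Density\<close>

text \<open>Distances are measured by the squared norm: \<open>\<parallel>f + g\<parallel>\<^sup>2 \<le> 2\<parallel>f\<parallel>\<^sup>2 + 2\<parallel>g\<parallel>\<^sup>2\<close> is pointwise and
  replaces Minkowski's inequality.\<close>

definition L2_closure :: "'a measure \<Rightarrow> ('a \<Rightarrow> real) set \<Rightarrow> ('a \<Rightarrow> real) set" where
  "L2_closure M V = {f \<in> L2_space M. \<forall>\<epsilon>>0. \<exists>g\<in>V \<inter> L2_space M.
     L2_inner M (\<lambda>x. f x - g x) (\<lambda>x. f x - g x) < \<epsilon>}"

lemma L2_closureD:
  assumes "f \<in> L2_closure M V" "\<epsilon> > 0"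
  obtains g where "g \<in> V" "g \<in> L2_space M" "L2_inner M (\<lambda>x. f x - g x) (\<lambda>x. f x - g x) < \<epsilon>"
  using assms by (auto simp: L2_closure_def)

lemma L2_closure_subset: "V \<inter> L2_space M \<subseteq> L2_closure M V"
proof
  fix f assume "f \<in> V \<inter> L2_space M"
  then show "f \<in> L2_closure M V"
    by (auto simp: L2_closure_def L2_inner_def intro!: bexI[of _ f])
qed

text \<open>Idempotence of the closure. Each of the two approximations gets
  \<open>\<epsilon> / 4\<close> because the inequality for the squared norm doubles both
  terms.\<close>

lemma L2_closure_closed:
  assumes f: "f \<in> L2_space M"
    and approx: "\<And>\<epsilon>. \<epsilon> > 0 \<Longrightarrow>
      \<exists>g\<in>L2_closure M V. L2_inner M (\<lambda>x. f x - g x) (\<lambda>x. f x - g x) < \<epsilon>"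
  shows "f \<in> L2_closure M V"
  unfolding L2_closure_def
proof (intro CollectI conjI f allI impI)
  fix \<epsilon> :: real assume "\<epsilon> > 0"
  then have e: "\<epsilon> / 4 > 0" by simp
  obtain g where g: "g \<in> L2_closure M V" "L2_inner M (\<lambda>x. f x - g x) (\<lambda>x. f x - g x) < \<epsilon> / 4"
    using approx[OF e] by blast
  obtain k where k: "k \<in> V" "k \<in> L2_space M"
    "L2_inner M (\<lambda>x. g x - k x) (\<lambda>x. g x - k x) < \<epsilon> / 4"
    using L2_closureD[OF g(1) e] by blast
  have gL2: "g \<in> L2_space M" using g(1) by (simp add: L2_closure_def)
  have "L2_inner M (\<lambda>x. f x - k x) (\<lambda>x. f x - k x) < \<epsilon>"
    using L2_inner_add_self_le[OF subspace_fun_diff[OF subspace_L2_space f gL2]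
        subspace_fun_diff[OF subspace_L2_space gL2 k(2)]] g(2) k(3) by simp
  then show "\<exists>g\<in>V \<inter> L2_space M. L2_inner M (\<lambda>x. f x - g x) (\<lambda>x. f x - g x) < \<epsilon>"
    using k by auto
qed

lemma subspace_L2_closure:
  assumes V: "fun_space.subspace V"
  shows "fun_space.subspace (L2_closure M V)"
proof (rule subspace_funI)
  show "(\<lambda>x. 0) \<in> L2_closure M V"
    using L2_closure_subset[of V M] subspace_fun_zero[OF V] subspace_fun_zero[OF subspace_L2_space]
    by blast
next
  fix f1 f2 assume f1: "f1 \<in> L2_closure M V" and f2: "f2 \<in> L2_closure M V"
  have L2: "f1 \<in> L2_space M" "f2 \<in> L2_space M" using f1 f2 by (auto simp: L2_closure_def)
  show "(\<lambda>x. f1 x + f2 x) \<in> L2_closure M V"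
    unfolding L2_closure_def
  proof (intro CollectI conjI allI impI subspace_fun_add[OF subspace_L2_space] L2)
    fix \<epsilon> :: real assume "\<epsilon> > 0"
    then have e: "\<epsilon> / 4 > 0" by simp
    obtain g1 where g1: "g1 \<in> V" "g1 \<in> L2_space M"
      "L2_inner M (\<lambda>x. f1 x - g1 x) (\<lambda>x. f1 x - g1 x) < \<epsilon> / 4"
      using L2_closureD[OF f1 e] by blast
    obtain g2 where g2: "g2 \<in> V" "g2 \<in> L2_space M"
      "L2_inner M (\<lambda>x. f2 x - g2 x) (\<lambda>x. f2 x - g2 x) < \<epsilon> / 4"
      using L2_closureD[OF f2 e] by blast
    have "L2_inner M (\<lambda>x. (f1 x + f2 x) - (g1 x + g2 x)) (\<lambda>x. (f1 x + f2 x) - (g1 x + g2 x)) < \<epsilon>"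
      using L2_inner_add_self_le[OF subspace_fun_diff[OF subspace_L2_space L2(1) g1(2)]
          subspace_fun_diff[OF subspace_L2_space L2(2) g2(2)]] g1(3) g2(3)
      by (simp add: algebra_simps)
    moreover have "(\<lambda>x. g1 x + g2 x) \<in> V \<inter> L2_space M"
      using g1 g2 subspace_fun_add[OF V] subspace_fun_add[OF subspace_L2_space] by auto
    ultimately show "\<exists>g\<in>V \<inter> L2_space M.
        L2_inner M (\<lambda>x. (f1 x + f2 x) - g x) (\<lambda>x. (f1 x + f2 x) - g x) < \<epsilon>"
      by (rule bexI)
  qed
next
  fix c f assume f: "f \<in> L2_closure M V"
  then have L2: "f \<in> L2_space M" by (simp add: L2_closure_def)
  show "(\<lambda>x. c * f x) \<in> L2_closure M V"
    unfolding L2_closure_def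
  proof (intro CollectI conjI allI impI subspace_fun_scale[OF subspace_L2_space L2])
    fix \<epsilon> :: real assume "\<epsilon> > 0"
    \<comment> \<open>Adding 1 makes the divisor positive also for \<open>c = 0\<close>.\<close>
    have c: "c\<^sup>2 + 1 > 0" by (simp add: add_nonneg_pos)
    obtain g where g: "g \<in> V" "g \<in> L2_space M"
      "L2_inner M (\<lambda>x. f x - g x) (\<lambda>x. f x - g x) < \<epsilon> / (c\<^sup>2 + 1)"
      using L2_closureD[OF f divide_pos_pos[OF \<open>\<epsilon> > 0\<close> c]] by blast
    let ?d = "L2_inner M (\<lambda>x. f x - g x) (\<lambda>x. f x - g x)"
    have "L2_inner M (\<lambda>x. c * f x - c * g x) (\<lambda>x. c * f x - c * g x) = c\<^sup>2 * ?d"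
      unfolding L2_inner_self by (simp flip: right_diff_distrib add: power_mult_distrib)
    also have "\<dots> \<le> (c\<^sup>2 + 1) * ?d"
      using L2_inner_self_nonneg[of M "\<lambda>x. f x - g x"] by (simp add: distrib_right)
    also have "\<dots> < \<epsilon>"
      using g(3) c by (simp add: pos_less_divide_eq mult.commute)
    finally have "L2_inner M (\<lambda>x. c * f x - c * g x) (\<lambda>x. c * f x - c * g x) < \<epsilon>" .
    moreover have "(\<lambda>x. c * g x) \<in> V \<inter> L2_space M"
      using g subspace_fun_scale[OF V] subspace_fun_scale[OF subspace_L2_space] by auto
    ultimately show "\<exists>g\<in>V \<inter> L2_space M. L2_inner M (\<lambda>x. c * f x - g x) (\<lambda>x. c * f x - g x) < \<epsilon>"
      by (rule bexI)
  qed
qed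

text \<open>Since |f - s n| \<le> 2 |f|, the squared differences are dominated by the integrable
  function 4 f^2, and dominated convergence makes their integrals tend to zero.\<close>

lemma L2_closure_dominated:
  assumes f: "f \<in> L2_space M" and s: "\<And>n. s n \<in> L2_closure M V"
    and bound: "\<And>n x. x \<in> space M \<Longrightarrow> \<bar>s n x\<bar> \<le> \<bar>f x\<bar>"
    and lim: "\<And>x. x \<in> space M \<Longrightarrow> (\<lambda>n. s n x) \<longlonglongrightarrow> f x"
  shows "f \<in> L2_closure M V"
proof (rule L2_closure_closed[OF f])
  fix \<epsilon> :: real assume "\<epsilon> > 0"
  have sm: "s n \<in> borel_measurable M" for n
    using s[of n] by (simp add: L2_closure_def L2_space_def)
  have "(\<lambda>n. \<integral>x. (f x - s n x)\<^sup>2 \<partial>M) \<longlonglongrightarrow> (\<integral>x. 0 \<partial>M)"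
  proof (rule integral_dominated_convergence[where w = "\<lambda>x. 4 * (f x)\<^sup>2"])
    show "integrable M (\<lambda>x. 4 * (f x)\<^sup>2)" "(\<lambda>x. (f x - s n x)\<^sup>2) \<in> borel_measurable M" for n
      using f sm by (auto simp: L2_space_def)
    show "AE x in M. (\<lambda>n. (f x - s n x)\<^sup>2) \<longlonglongrightarrow> 0"
    proof (rule AE_I2)
      fix x assume "x \<in> space M"
      have "(\<lambda>n. (f x - s n x)\<^sup>2) \<longlonglongrightarrow> (f x - f x)\<^sup>2"
        using lim[OF \<open>x \<in> space M\<close>] by (intro tendsto_intros)
      then show "(\<lambda>n. (f x - s n x)\<^sup>2) \<longlonglongrightarrow> 0" by simp
    qed
    show "AE x in M. norm ((f x - s n x)\<^sup>2) \<le> 4 * (f x)\<^sup>2" for n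
    proof (rule AE_I2)
      fix x assume "x \<in> space M"
      then have "\<bar>f x - s n x\<bar> \<le> 2 * \<bar>f x\<bar>"
        using bound[of x n] by linarith
      then have "\<bar>f x - s n x\<bar>\<^sup>2 \<le> (2 * \<bar>f x\<bar>)\<^sup>2"
        by (intro power_mono) auto
      then show "norm ((f x - s n x)\<^sup>2) \<le> 4 * (f x)\<^sup>2"
        by (simp add: power_mult_distrib)
    qed
  qed simp
  then have "\<forall>\<^sub>F n in sequentially. (\<integral>x. (f x - s n x)\<^sup>2 \<partial>M) < \<epsilon>"
    using \<open>\<epsilon> > 0\<close> by (intro order_tendstoD(2)[where a = \<epsilon>]) auto
  then obtain n where "(\<integral>x. (f x - s n x)\<^sup>2 \<partial>M) < \<epsilon>"
    by (auto simp: eventually_sequentially)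
  then show "\<exists>g\<in>L2_closure M V. L2_inner M (\<lambda>x. f x - g x) (\<lambda>x. f x - g x) < \<epsilon>"
    using s by (auto simp: L2_inner_self)
qed

section \<open>From a generating family of sets to all square-integrable functions\<close>

context finite_measure
begin

text \<open>The sets whose indicators lie in the closure form a Dynkin class containing the
  intersection-stable generator \<open>G\<close>. Complements are differences from the indicator of
  the whole space, which is why \<open>space_V\<close> is assumed separately.\<close>

lemma indicator_in_L2_closure:
  assumes V: "fun_space.subspace V" and G: "Int_stable G" "G \<subseteq> Pow (space M)"
    and sets: "sets M = sigma_sets (space M) G"
    and G_V: "\<And>A. A \<in> G \<Longrightarrow> indicator A \<in> V" and space_V: "indicator (space M) \<in> V"
    and A: "A \<in> sets M"
  shows "indicator A \<in> L2_closure M V"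
  using G A[unfolded sets]
proof (induction rule: sigma_sets_induct_disjoint)
  case (basic A)
  then show ?case
    using L2_closure_subset[of V M] G_V indicator_L2_space[of A] sets by auto
next
  case empty
  then show ?case
    using subspace_fun_zero[OF subspace_L2_closure[OF V]] by (simp add: indicator_def[abs_def])
next
  case (compl A)
  have "A \<subseteq> space M"
    using compl(1) sets sets.sets_into_space[of A M] by auto
  then have eq: "indicator (space M - A) = (\<lambda>x. indicator (space M) x - indicator A x :: real)"
    by (auto simp: fun_eq_iff indicator_def)
  show ?case
    unfolding eq
    using L2_closure_subset[of V M] space_V indicator_L2_space[of "space M"] compl(2)
    by (intro subspace_fun_diff[OF subspace_L2_closure[OF V]]) auto
next
  case (union A)
  have AM: "A i \<in> sets M" for i using union(2) sets by auto
  show ?case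
  \<comment> \<open>Finite partial unions have sums of indicators as their indicators, by
    disjointness, and they increase to the full union.\<close>
  proof (rule L2_closure_dominated[where s = "\<lambda>n. indicator (\<Union>i<n. A i)"])
    show "indicator (\<Union>i. A i) \<in> L2_space M"
      using AM by (intro indicator_L2_space) auto
    show "indicator (\<Union>i<n. A i) \<in> L2_closure M V" for n
    proof -
      have "disjoint_family_on A {..<n}"
        using union(1) by (auto simp: disjoint_family_on_def)
      then have "(indicator (\<Union>i<n. A i) :: 'a \<Rightarrow> real) = (\<lambda>x. \<Sum>i<n. 1 * indicator (A i) x)"
        using indicator_UN_disjoint[of "{..<n}" A] by (auto simp: fun_eq_iff)
      then show ?thesis
        using union(3) by (simp only:) (intro subspace_fun_sum subspace_L2_closure V)
    qed
    show "\<bar>indicator (\<Union>i<n. A i) x\<bar> \<le> \<bar>indicator (\<Union>i. A i) x :: real\<bar>" for n x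
      by (auto simp: indicator_def)
    show "(\<lambda>n. indicator (\<Union>i<n. A i) x :: real) \<longlonglongrightarrow> indicator (\<Union>i. A i) x" for x
      by (rule LIMSEQ_indicator_UN)
  qed
qed

lemma L2_space_subset_closure:
  assumes V: "fun_space.subspace V" and G: "Int_stable G" "G \<subseteq> Pow (space M)"
    and sets: "sets M = sigma_sets (space M) G"
    and G_V: "\<And>A. A \<in> G \<Longrightarrow> indicator A \<in> V" and space_V: "indicator (space M) \<in> V"
  shows "L2_space M \<subseteq> L2_closure M V"
proof -
  note cl = subspace_L2_closure[OF V, of M]
  \<comment> \<open>Square integrability descends from a function to the nonnegative pieces below
    it: the summands of a sum and the members of an increasing sequence.\<close>
  have dom: "v \<in> L2_space M"
    if "u \<in> L2_space M" "v \<in> borel_measurable M" "\<And>x. x \<in> space M \<Longrightarrow> 0 \<le> v x \<and> v x \<le> u x" for u v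
  proof -
    have "integrable M (\<lambda>x. (v x)\<^sup>2)"
    proof (rule Bochner_Integration.integrable_bound)
      show "integrable M (\<lambda>x. (u x)\<^sup>2)" using that(1) by (simp add: L2_space_def)
      show "AE x in M. norm ((v x)\<^sup>2) \<le> norm ((u x)\<^sup>2)"
        using that(3) by (intro AE_I2) (simp add: power_mono)
    qed (use that(2) in simp)
    then show ?thesis using that(2) by (simp add: L2_space_def)
  qed
  \<comment> \<open>The claim is an implication because the induction ranges over all nonnegative
    measurable functions, square-integrable or not.\<close>
  have nonneg: "u \<in> L2_space M \<longrightarrow> u \<in> L2_closure M V"
    if "u \<in> borel_measurable M" "\<And>x. 0 \<le> u x" for u
    using that
  proof (induction rule: borel_measurable_induct_real)
    case (set A)
    then show ?case using indicator_in_L2_closure[OF assms] by simp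
  next
    case (mult u c)
    show ?case
    \<comment> \<open>For \<open>c = 0\<close>, square integrability of the product says nothing
      about \<open>u\<close>, so the induction hypothesis is out of reach; the product is then the
      zero function.\<close>
    proof (cases "c = 0")
      case True
      then show ?thesis using subspace_fun_zero[OF cl] by simp
    next
      case False
      then have "u \<in> L2_space M" if "(\<lambda>x. c * u x) \<in> L2_space M"
        using subspace_fun_scale[OF subspace_L2_space that, of "1 / c"] by simp
      then show ?thesis
        using mult subspace_fun_scale[OF cl] by blast
    qed
  next
    case (add u v)
    have "u \<in> L2_space M" "v \<in> L2_space M" if "(\<lambda>x. v x + u x) \<in> L2_space M"
      using dom[OF that] add by auto
    then show ?case
      using add subspace_fun_add[OF cl] by blast
  next
    case (seq U)
    have le: "U i x \<le> u x" if "x \<in> space M" for i x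
      using seq.hyps(3) incseq_le[OF _ seq.hyps(4)[OF that]] by (auto simp: incseq_def le_fun_def)
    show ?case
    proof
      assume u: "u \<in> L2_space M"
      show "u \<in> L2_closure M V"
      proof (rule L2_closure_dominated[OF u, where s = U])
        show "U n \<in> L2_closure M V" for n
          using seq.IH[of n] dom[OF u seq.hyps(1)[of n]] le seq.hyps(2) by auto
        show "\<bar>U n x\<bar> \<le> \<bar>u x\<bar>" if "x \<in> space M" for n x
          using le[OF that, of n] seq.hyps(2)[of n x] by linarith
      qed (use seq.hyps(4) in auto)
    qed
  qed
  show ?thesis
  proof
    fix f assume f: "f \<in> L2_space M"
    let ?p = "\<lambda>x. max 0 (f x)" and ?n = "\<lambda>x. max 0 (- f x)"
    have fm: "f \<in> borel_measurable M" using f by (simp add: L2_space_def)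
    have abs: "(\<lambda>x. \<bar>f x\<bar>) \<in> L2_space M" using f by (auto simp: L2_space_def)
    have "?p \<in> L2_closure M V" "?n \<in> L2_closure M V"
      using nonneg[of ?p] nonneg[of ?n] dom[OF abs, of ?p] dom[OF abs, of ?n] fm by auto
    then have "(\<lambda>x. ?p x - ?n x) \<in> L2_closure M V"
      by (rule subspace_fun_diff[OF cl])
    moreover have "(\<lambda>x. ?p x - ?n x) = f" by (auto simp: fun_eq_iff)
    ultimately show "f \<in> L2_closure M V" by simp
  qed
qed

end

section \<open>Sequences of partitions\<close>

text \<open>A point of \<open>E\<close> lies in some \<open>F\<close> of the finer partition, and
  the coarse cell containing \<open>F\<close> meets \<open>E\<close>, hence equals it by
  disjointness.\<close>

lemma refines_children:
  assumes "partition_on \<Omega> P" "refines \<Omega> Q P" "E \<in> P"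
  shows "\<Union>{F \<in> Q. F \<subseteq> E} = E"
proof
  show "E \<subseteq> \<Union>{F \<in> Q. F \<subseteq> E}"
  proof
    fix x assume x: "x \<in> E"
    then have "x \<in> \<Omega>" using assms by (auto simp: partition_on_def)
    then obtain F where F: "F \<in> Q" "x \<in> F"
      using assms(2) by (auto simp: refines_def partition_on_def)
    then obtain E' where E': "E' \<in> P" "F \<subseteq> E'"
      using assms(2) by (auto simp: refines_def)
    moreover have "E' = E"
      using E' x F assms(1,3) by (auto simp: partition_on_def disjoint_def)
    ultimately have "F \<subseteq> E" by simp
    then show "x \<in> \<Union>{F \<in> Q. F \<subseteq> E}" using F by auto
  qed
qed auto

lemma refines_seq_mono:
  assumes "\<And>n. refines \<Omega> (\<E> (Suc n)) (\<E> n)" "m \<le> n"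
  shows "refines \<Omega> (\<E> n) (\<E> m)"
  using assms(2)
proof (induction rule: dec_induct)
  case base
  then show ?case using assms(1)[of m] by (intro refines_refl) (simp add: refines_def)
next
  case (step n)
  then show ?case using assms(1)[of n] by (meson refines_trans)
qed

text \<open>Two cells of any levels are either disjoint or nested. The empty set is inserted to
  accommodate the disjoint case.\<close>

lemma refines_seq_Int_stable:
  assumes "\<And>n. refines \<Omega> (\<E> (Suc n)) (\<E> n)"
  shows "Int_stable (insert {} (\<Union>n. \<E> n))"
proof -
  have *: "E \<inter> F \<in> {{}, F}" if E: "E \<in> \<E> m" and F: "F \<in> \<E> n" and mn: "m \<le> n" for E F m n
  proof -
    have "refines \<Omega> (\<E> n) (\<E> m)" using assms mn by (rule refines_seq_mono)
    then obtain E' where "E' \<in> \<E> m" "F \<subseteq> E'" "disjoint (\<E> m)"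
      using F by (auto simp: refines_def partition_on_def)
    then show ?thesis
      using E by (cases "E = E'") (auto simp: disjoint_def)
  qed
  show ?thesis
  proof (rule Int_stableI)
    fix E F assume "E \<in> insert {} (\<Union>n. \<E> n)" "F \<in> insert {} (\<Union>n. \<E> n)"
    moreover have "E \<inter> F \<in> insert {} (\<Union>n. \<E> n)" if EF: "E \<in> \<E> m" "F \<in> \<E> n" for m n
      using *[OF EF] *[OF EF(2,1)] EF by (cases "m \<le> n") (auto simp: Int_commute)
    ultimately show "E \<inter> F \<in> insert {} (\<Union>n. \<E> n)" by auto
  qed
qed

text \<open>Boundedness makes the supremum in \<open>diameter\<close> a genuine upper bound, and
  finiteness does the same for the maximum in \<open>mesh\<close>.\<close>

lemma partition_cell_small:
  fixes \<Omega> :: "'a::metric_space set"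
  assumes "bounded \<Omega>" and fin: "finite P" and P: "partition_on \<Omega> P"
    and E: "E \<in> P" "x \<in> E" "y \<in> E"
  shows "dist x y \<le> mesh P"
proof -
  have "bounded E"
    using assms by (auto simp: partition_on_def intro: bounded_subset)
  then have "dist x y \<le> diameter E"
    using E by (intro diameter_bounded_bound)
  also have "\<dots> \<le> mesh P"
    unfolding mesh_def using fin E by (intro Max_ge) auto
  finally show ?thesis .
qed

text \<open>Once the mesh is below the radius of a ball around a point, the cell of that point fits
  into the ball. A relatively open set is thus the union of the cells inside it, a countable union
  because each level is finite.\<close>

lemma sets_eq_sigma_sets_cells:
  fixes \<Omega> :: "'a::metric_space set"
  assumes bdd: "bounded \<Omega>" and fin: "\<And>n. finite (\<E> n)" and part: "\<And>n. partition_on \<Omega> (\<E> n)"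
    and open_cell: "\<And>n E. E \<in> \<E> n \<Longrightarrow> openin (top_of_set \<Omega>) E"
    and mesh: "(\<lambda>n. mesh (\<E> n)) \<longlonglongrightarrow> 0"
  shows "sets (restrict_space borel \<Omega>) = sigma_sets \<Omega> (insert {} (\<Union>n. \<E> n))"
proof
  let ?G = "insert {} (\<Union>n. \<E> n)"
  have G_sub: "?G \<subseteq> Pow \<Omega>"
    using part by (auto simp: partition_on_def)
  have "?G \<subseteq> sets (restrict_space borel \<Omega>)"
  proof
    fix E assume "E \<in> ?G"
    then have "openin (top_of_set \<Omega>) E" using open_cell by auto
    then obtain U where "open U" "E = \<Omega> \<inter> U" by (auto simp: openin_open)
    then show "E \<in> sets (restrict_space borel \<Omega>)" by (auto simp: sets_restrict_space)
  qed
  then show "sigma_sets \<Omega> ?G \<subseteq> sets (restrict_space borel \<Omega>)"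
    using sets.sigma_sets_subset[of ?G "restrict_space borel \<Omega>"]
    by (simp add: space_restrict_space)
  have open_in: "\<Omega> \<inter> U \<in> sigma_sets \<Omega> ?G" if "open U" for U
  proof -
    let ?C = "{E \<in> (\<Union>n. \<E> n). E \<subseteq> U}"
    have "\<Omega> \<inter> U \<subseteq> \<Union>?C"
    proof
      fix x assume x: "x \<in> \<Omega> \<inter> U"
      then obtain e where e: "e > 0" "ball x e \<subseteq> U"
        using \<open>open U\<close> by (auto simp: open_contains_ball)
      have "\<forall>\<^sub>F n in sequentially. mesh (\<E> n) < e"
        using mesh e(1) by (rule order_tendstoD)
      then obtain n where n: "mesh (\<E> n) < e"
        by (auto simp: eventually_sequentially)
      obtain E where E: "E \<in> \<E> n" "x \<in> E"
        using x part[of n] by (auto simp: partition_on_def)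
      have "E \<subseteq> ball x e"
        using partition_cell_small[OF bdd fin part E] n by fastforce
      then show "x \<in> \<Union>?C" using E e by blast
    qed
    then have eq: "\<Omega> \<inter> U = \<Union>?C" using G_sub by blast
    have "countable (\<Union>n. \<E> n)" using fin by (intro countable_UN) (auto intro: countable_finite)
    then have "countable ?C" by (rule countable_subset[rotated]) auto
    then show ?thesis
      unfolding eq using G_sub
      by (intro sigma_algebra.countable_Union[OF sigma_algebra_sigma_sets]) auto
  qed
  \<comment> \<open>Taking traces on \<open>\<Omega>\<close> turns complements into complements
    relative to \<open>\<Omega>\<close> and respects countable unions, so the claim spreads from
    open sets to Borel sets.\<close>
  have "\<Omega> \<inter> A \<in> sigma_sets \<Omega> ?G" if "A \<in> sigma_sets UNIV {S. open S}" for A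
    using that
  proof induction
    case (Basic A)
    then show ?case using open_in by auto
  next
    case Empty
    then show ?case by (simp add: sigma_sets.Empty)
  next
    case (Compl A)
    have "\<Omega> \<inter> (UNIV - A) = \<Omega> - \<Omega> \<inter> A" by auto
    then show ?case using Compl.IH by (simp add: sigma_sets.Compl)
  next
    case (Union A)
    have "\<Omega> \<inter> (\<Union>i. A i) = (\<Union>i. \<Omega> \<inter> A i)" by auto
    then show ?case using Union.IH by (simp only: sigma_sets.Union)
  qed
  then show "sets (restrict_space borel \<Omega>) \<subseteq> sigma_sets \<Omega> ?G"
    by (auto simp: sets_restrict_space borel_def)
qed

section \<open>Orthonormality of the Haar functions and the span of their levels\<close>

locale haar_system = finite_measure M for M :: "'a measure" +
  fixes \<Omega> :: "'a set" and \<E> :: "nat \<Rightarrow> 'a set set" and I :: "nat \<Rightarrow> nat set"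
    and h :: "nat \<Rightarrow> nat \<Rightarrow> 'a \<Rightarrow> real" and sub :: "nat \<Rightarrow> 'a set \<Rightarrow> 'a set list"
    and \<sigma> :: "nat \<Rightarrow> nat \<Rightarrow> 'a set \<times> nat"
  assumes fin: "\<And>n. finite (\<E> n)" and part: "\<And>n. partition_on \<Omega> (\<E> n)"
    and ref: "\<And>n. refines \<Omega> (\<E> (Suc n)) (\<E> n)" and E0: "\<E> 0 = {\<Omega>}"
    and cell_sets: "\<And>n E. E \<in> \<E> n \<Longrightarrow> E \<in> sets M"
    and pos: "\<And>n E. E \<in> \<E> n \<Longrightarrow> measure M E > 0"
    and I0: "I 0 = {0}" and h0: "h 0 0 = (\<lambda>x. indicator \<Omega> x * measure M \<Omega> powr (- 1 / 2))"
    and sub: "\<And>n E. E \<in> \<E> n \<Longrightarrow> distinct (sub n E) \<and> set (sub n E) = {F \<in> \<E> (Suc n). F \<subseteq> E}"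
    and \<sigma>: "\<And>n. bij_betw (\<sigma> n) (I (Suc n)) (SIGMA E : \<E> n. {..<length (haar_block M E (sub n E))})"
    and h_Suc: "\<And>n m. m \<in> I (Suc n) \<Longrightarrow>
      h m (Suc n) = (case \<sigma> n m of (E, k) \<Rightarrow> haar_block M E (sub n E) ! k)"
begin

text \<open>These are the functions that are constant on each cell of level \<open>n\<close> and
  zero outside \<open>\<Omega>\<close>.\<close>

abbreviation cell_span :: "nat \<Rightarrow> ('a \<Rightarrow> real) set" where
  "cell_span n \<equiv> fun_space.span (indicator ` \<E> n)"

lemma block:
  assumes E: "E \<in> \<E> n"
  defines "b \<equiv> haar_block M E (sub n E)"
  shows "L2_orthonormal M {..<length b} ((!) b)"
    and "set b \<subseteq> fun_space.span (indicator ` set (sub n E))"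
    and "f \<in> set b \<Longrightarrow> L2_inner M (indicator E) f = 0"
    and "indicator ` set (sub n E) \<subseteq> fun_space.span (insert (indicator E) (set b))"
proof -
  have U: "\<Union>(set (sub n E)) = E"
    using sub[OF E] refines_children[OF part ref E] by simp
  have "E \<noteq> {}" using part[of n] E by (auto simp: partition_on_def)
  then have ne: "sub n E \<noteq> []" using U by auto
  have disj: "disjoint (set (sub n E))"
    using part[of "Suc n"] sub[OF E] by (auto simp: partition_on_def disjoint_def)
  have F: "F \<in> sets M \<and> measure M F > 0" if "F \<in> set (sub n E)" for F
    using that sub[OF E] cell_sets[of F "Suc n"] pos[of F "Suc n"] by auto
  note * = haar_block_correct[OF conjunct1[OF sub[OF E]] ne disj U F]
  show "L2_orthonormal M {..<length b} ((!) b)"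
    and "set b \<subseteq> fun_space.span (indicator ` set (sub n E))"
    and "f \<in> set b \<Longrightarrow> L2_inner M (indicator E) f = 0"
    and "indicator ` set (sub n E) \<subseteq> fun_space.span (insert (indicator E) (set b))"
    unfolding b_def by (rule *; assumption)+
qed

lemma cell_span_Suc: "cell_span n \<subseteq> cell_span (Suc n)"
proof (rule fun_space.span_minimal[OF _ fun_space.subspace_span], rule image_subsetI)
  fix E assume E: "E \<in> \<E> n"
  let ?C = "{F \<in> \<E> (Suc n). F \<subseteq> E}"
  have "indicator (\<Union>?C) \<in> fun_space.span (indicator ` ?C :: ('a \<Rightarrow> real) set)"
    using fin part[of "Suc n"]
    by (intro indicator_Union_in_span) (auto simp: partition_on_def disjoint_def)
  moreover have "fun_space.span (indicator ` ?C) \<subseteq> cell_span (Suc n)"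
    by (intro fun_space.span_mono) auto
  ultimately show "indicator E \<in> cell_span (Suc n)"
    using refines_children[OF part ref E] by auto
qed

lemma cell_span_mono: "m \<le> n \<Longrightarrow> cell_span m \<subseteq> cell_span n"
  by (rule lift_Suc_mono_le[of cell_span]) (rule cell_span_Suc)

lemma cell_span_L2: "cell_span n \<subseteq> L2_space M"
  using cell_sets
  by (intro fun_space.span_minimal subspace_L2_space) (auto intro: indicator_L2_space)

lemma h_cell:
  assumes "m \<in> I (Suc n)"
  obtains E k where "\<sigma> n m = (E, k)" "E \<in> \<E> n" "k < length (haar_block M E (sub n E))"
    "h m (Suc n) = haar_block M E (sub n E) ! k"
proof -
  obtain E k where Ek: "\<sigma> n m = (E, k)" by (cases "\<sigma> n m")
  moreover have "\<sigma> n m \<in> (SIGMA E : \<E> n. {..<length (haar_block M E (sub n E))})"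
    using bij_betwE[OF \<sigma>] assms by auto
  ultimately show ?thesis using that h_Suc[OF assms] by auto
qed

text \<open>The subcells of \<open>E\<close> belong to level \<open>Suc n\<close> and lie inside
  \<open>E\<close>; both facts pass from their indicators to the span containing the block.\<close>

lemma block_function:
  assumes "E \<in> \<E> n" "f \<in> set (haar_block M E (sub n E))"
  shows "f \<in> cell_span (Suc n)" and "x \<notin> E \<Longrightarrow> f x = 0"
    and "L2_inner M (indicator E) f = 0"
proof -
  have f: "f \<in> fun_space.span (indicator ` set (sub n E))"
    using block(2) assms by blast
  moreover have "fun_space.span (indicator ` set (sub n E)) \<subseteq> cell_span (Suc n)"
    using sub[OF assms(1)] by (intro fun_space.span_mono) auto
  ultimately show "f \<in> cell_span (Suc n)" by blast
  let ?Z = "{g :: 'a \<Rightarrow> real. \<forall>x. x \<notin> E \<longrightarrow> g x = 0}"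
  have "fun_space.span (indicator ` set (sub n E)) \<subseteq> ?Z"
    using sub[OF assms(1)]
    by (intro fun_space.span_minimal) (auto intro: subspace_funI simp: indicator_def)
  then show "x \<notin> E \<Longrightarrow> f x = 0" using f by blast
  show "L2_inner M (indicator E) f = 0" by (rule block(3)[OF assms])
qed

lemma h_in_cell_span: "m \<in> I n \<Longrightarrow> h m n \<in> cell_span n"
proof (cases n)
  case 0
  assume "m \<in> I n"
  then have "h m n = (\<lambda>x. measure M \<Omega> powr (- 1 / 2) * indicator \<Omega> x)"
    using 0 I0 h0 by (auto simp: mult.commute)
  also have "\<dots> \<in> cell_span n"
    unfolding 0 E0 by (intro subspace_fun_scale fun_space.subspace_span fun_space.span_base) auto
  finally show ?thesis .
next
  case (Suc n')
  assume "m \<in> I n"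
  then have "m \<in> I (Suc n')" using Suc by simp
  then obtain E k where "E \<in> \<E> n'" "k < length (haar_block M E (sub n' E))"
    "h m (Suc n') = haar_block M E (sub n' E) ! k"
    by (rule h_cell)
  then show ?thesis unfolding Suc by (auto intro: block_function(1))
qed

lemma h_L2: "m \<in> I n \<Longrightarrow> h m n \<in> L2_space M"
  using h_in_cell_span cell_span_L2 by blast

text \<open>It suffices to test indicators of cells of level \<open>n\<close>: that of
  \<open>E\<close> is handled by the construction of the block, and all others have support disjoint
  from that of \<open>f\<close>.\<close>

lemma block_orthogonal_coarse:
  assumes E: "E \<in> \<E> n" and f: "f \<in> set (haar_block M E (sub n E))" and g: "g \<in> cell_span n"
  shows "L2_inner M f g = 0"
proof (rule L2_orthogonal_span[OF _ g])
  show "f \<in> L2_space M" using block_function(1)[OF E f] cell_span_L2 by blast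
  fix v :: "'a \<Rightarrow> real" assume "v \<in> indicator ` \<E> n"
  then obtain F where F: "F \<in> \<E> n" "v = indicator F" by auto
  have "L2_inner M f v = 0"
  proof (cases "F = E")
    case True
    then show ?thesis using block_function(3)[OF E f] F by (simp add: L2_inner_commute)
  next
    case False
    then have "F \<inter> E = {}" using F E part[of n] by (auto simp: partition_on_def disjoint_def)
    then have "(\<lambda>x. f x * v x) = (\<lambda>x. 0)"
      using block_function(2)[OF E f] F by (auto simp: fun_eq_iff indicator_def)
    then show ?thesis by (simp only: L2_inner_def integral_zero)
  qed
  then show "v \<in> L2_space M \<and> L2_inner M f v = 0"
    using F cell_sets by (auto intro: indicator_L2_space)
qed

text \<open>With \<open>n' = Suc l\<close>, the finer function comes from a block over a cell of
  level \<open>l\<close>, and \<open>n \<le> l\<close> puts the coarser one into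
  \<open>cell_span l\<close>.\<close>

lemma h_orthogonal_level:
  assumes "m \<in> I n" "m' \<in> I n'" "n < n'"
  shows "L2_inner M (h m' n') (h m n) = 0"
proof -
  obtain l where l: "n' = Suc l" using assms(3) by (cases n') auto
  obtain E k where E: "E \<in> \<E> l" "k < length (haar_block M E (sub l E))"
    "h m' (Suc l) = haar_block M E (sub l E) ! k"
    using h_cell assms(2) unfolding l by blast
  have "h m n \<in> cell_span l"
    using h_in_cell_span[OF assms(1)] cell_span_mono[of n l] assms(3) l by auto
  then show ?thesis
    unfolding l E(3) by (rule block_orthogonal_coarse[OF E(1) nth_mem[OF E(2)]])
qed

lemma h_orthonormal_level:
  assumes "m \<in> I n" "m' \<in> I n"
  shows "L2_inner M (h m n) (h m' n) = (if m = m' then 1 else 0)"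
proof (cases n)
  case 0
  have \<Omega>: "\<Omega> \<in> sets M" "measure M \<Omega> > 0" using E0 cell_sets[of \<Omega> 0] pos[of \<Omega> 0] by auto
  have "L2_inner M (h 0 0) (h 0 0) = (\<integral>x. (measure M \<Omega> powr (- 1 / 2))\<^sup>2 * indicator \<Omega> x \<partial>M)"
    unfolding L2_inner_self h0 by (intro Bochner_Integration.integral_cong) (auto simp: indicator_def)
  also have "\<dots> = (measure M \<Omega> powr (- 1 / 2))\<^sup>2 * measure M \<Omega>"
    using \<Omega> by (simp add: emeasure_eq_measure)
  also have "(measure M \<Omega> powr (- 1 / 2))\<^sup>2 = measure M \<Omega> powr - 1"
    by (simp add: power2_eq_square flip: powr_add)
  also have "measure M \<Omega> powr - 1 * measure M \<Omega> = 1"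
    using \<Omega>(2) by (simp add: powr_minus)
  finally show ?thesis using 0 I0 assms by simp
next
  case (Suc l)
  obtain E k where E: "\<sigma> l m = (E, k)" "E \<in> \<E> l" "k < length (haar_block M E (sub l E))"
    "h m (Suc l) = haar_block M E (sub l E) ! k"
    using h_cell assms(1) unfolding Suc by blast
  obtain E' k' where E': "\<sigma> l m' = (E', k')" "E' \<in> \<E> l" "k' < length (haar_block M E' (sub l E'))"
    "h m' (Suc l) = haar_block M E' (sub l E') ! k'"
    using h_cell assms(2) unfolding Suc by blast
  \<comment> \<open>Injectivity of the numbering: distinct indices of one level differ in the cell
    or in the position within its block.\<close>
  have inj: "m = m' \<longleftrightarrow> (E, k) = (E', k')"
    using bij_betw_imp_inj_on[OF \<sigma>[of l]] assms E(1) E'(1) unfolding Suc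
    by (metis inj_onD)
  show ?thesis
  proof (cases "E = E'")
    case True
    then show ?thesis
      using block(1)[OF E(2)] E E' inj unfolding Suc by (simp add: L2_orthonormal_def)
  next
    case False
    then have "E \<inter> E' = {}"
      using E E' part[of l] by (auto simp: partition_on_def disjoint_def)
    then have "(\<lambda>x. h m n x * h m' n x) = (\<lambda>x. 0)"
      using block_function(2)[OF E(2) nth_mem[OF E(3)]]
        block_function(2)[OF E'(2) nth_mem[OF E'(3)]]
      unfolding Suc E(4) E'(4) fun_eq_iff by auto
    then have "L2_inner M (h m n) (h m' n) = 0"
      by (simp only: L2_inner_def integral_zero)
    then show ?thesis using False inj by simp
  qed
qed

lemma h_orthonormal: "L2_orthonormal M {(m, n). m \<in> I n} (\<lambda>(m, n). h m n)"
  unfolding L2_orthonormal_def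
proof (intro conjI ballI)
  show "(case i of (m, n) \<Rightarrow> h m n) \<in> L2_space M" if "i \<in> {(m, n). m \<in> I n}" for i
    using that h_L2 by auto
  fix i j assume ij: "i \<in> {(m, n). m \<in> I n}" "j \<in> {(m, n). m \<in> I n}"
  obtain m n m' n' where eq: "i = (m, n)" "j = (m', n')" by (cases i, cases j)
  then have mem: "m \<in> I n" "m' \<in> I n'" using ij by auto
  consider "n < n'" | "n' < n" | "n = n'" by linarith
  then have "L2_inner M (h m n) (h m' n') = (if (m, n) = (m', n') then 1 else 0)"
  proof cases
    case 1
    then show ?thesis using h_orthogonal_level[OF mem] by (simp add: L2_inner_commute)
  next
    case 2
    then show ?thesis using h_orthogonal_level[OF mem(2,1)] by simp
  next
    case 3
    then show ?thesis using h_orthonormal_level[of m n m'] mem by simp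
  qed
  then show "L2_inner M (case i of (m, n) \<Rightarrow> h m n) (case j of (m, n) \<Rightarrow> h m n) = (if i = j then 1 else 0)"
    by (simp add: eq)
qed

lemma cells_in_haar_span:
  "indicator ` \<E> n \<subseteq> fun_space.span ((\<lambda>(m, n). h m n) ` {(m, n). m \<in> I n})" (is "_ \<subseteq> ?H")
proof (induction n)
  case 0
  have "measure M \<Omega> > 0" using E0 pos[of \<Omega> 0] by simp
  \<comment> \<open>The factor undoes the normalisation of \<open>h 0 0\<close>; the two powers
    cancel because the measure is positive.\<close>
  then have eq: "indicator \<Omega> = (\<lambda>x. measure M \<Omega> powr (1 / 2) * h 0 0 x)"
    by (simp add: h0 fun_eq_iff mult.left_commute powr_minus flip: powr_add)
  have "h 0 0 \<in> ?H"
    by (rule fun_space.span_base) (use I0 in force)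
  then show ?case
    unfolding E0 using subspace_fun_scale[OF fun_space.subspace_span] eq by simp
next
  case (Suc n)
  show ?case
  proof (rule image_subsetI)
    fix F assume F: "F \<in> \<E> (Suc n)"
    then obtain E where E: "E \<in> \<E> n" "F \<subseteq> E" using ref[of n] by (auto simp: refines_def)
    have "set (haar_block M E (sub n E)) \<subseteq> ?H"
    proof
      fix f assume "f \<in> set (haar_block M E (sub n E))"
      then obtain k where k: "k < length (haar_block M E (sub n E))" "f = haar_block M E (sub n E) ! k"
        by (auto simp: in_set_conv_nth)
      \<comment> \<open>Surjectivity of the numbering: every function of the block occurs among the
        \<open>h m (Suc n)\<close>.\<close>
      then have "(E, k) \<in> \<sigma> n ` I (Suc n)"
        using bij_betw_imp_surj_on[OF \<sigma>[of n]] E by auto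
      then obtain m where m: "m \<in> I (Suc n)" "\<sigma> n m = (E, k)" by auto
      then have "f = h m (Suc n)" using h_Suc k by auto
      then show "f \<in> ?H" using m by (intro fun_space.span_base) force
    qed
    then have "insert (indicator E) (set (haar_block M E (sub n E))) \<subseteq> ?H"
      using Suc E by auto
    then have "fun_space.span (insert (indicator E) (set (haar_block M E (sub n E)))) \<subseteq> ?H"
      by (rule fun_space.span_minimal[OF _ fun_space.subspace_span])
    moreover have "F \<in> set (sub n E)" using sub[OF E(1)] F E by auto
    ultimately show "indicator F \<in> ?H" using block(4)[OF E(1)] by auto
  qed
qed

end

section \<open>Completeness of the Haar basis from orthonormality and density\<close>

theorem proposition3p5:
  fixes \<Omega> :: "'a::metric_space set"
    and \<E> :: "nat \<Rightarrow> 'a set set"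
    and \<mu> :: "'a measure"
    and I :: "nat \<Rightarrow> nat set"
    and h :: "nat \<Rightarrow> nat \<Rightarrow> 'a \<Rightarrow> real"
  assumes "\<Omega> \<noteq> {}" and "compact \<Omega>" and "totally_disconnected \<Omega>"
    and "\<And>n. finite (\<E> n)" and "\<And>n. partition_on \<Omega> (\<E> n)"
    and "\<And>n E. E \<in> \<E> n \<Longrightarrow> clopen_in \<Omega> E"
    and "\<And>n. refines \<Omega> (\<E> (Suc n)) (\<E> n)"
    and "\<E> 0 = {\<Omega>}"
    and "(\<lambda>n. mesh (\<E> n)) \<longlonglongrightarrow> 0"
    and "finite_measure \<mu>" and "sets \<mu> = sets (restrict_space borel \<Omega>)"
    and "\<And>n E. E \<in> \<E> n \<Longrightarrow> measure \<mu> E > 0"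
    and "haar_basis \<Omega> \<mu> \<E> I h"
  shows "L2_complete_orthonormal_basis \<mu> {(m, n). m \<in> I n} (\<lambda>(m, n). h m n)"
proof -
  let ?G = "insert {} (\<Union>n. \<E> n)"
  let ?H = "fun_space.span ((\<lambda>(m, n). h m n) ` {(m, n). m \<in> I n})"
  have space: "space \<mu> = \<Omega>"
    using sets_eq_imp_space_eq[OF assms(11)] by (simp add: space_restrict_space)
  have sets: "sets \<mu> = sigma_sets \<Omega> ?G"
    using sets_eq_sigma_sets_cells[OF compact_imp_bounded[OF assms(2)] assms(4,5) _ assms(9)]
      assms(6,11) by (simp add: clopen_in_def)
  obtain sub where sub: "\<forall>n. \<forall>E\<in>\<E> n.
      distinct (sub n E) \<and> set (sub n E) = {F \<in> \<E> (Suc n). F \<subseteq> E}"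
    and ex: "\<forall>n. \<exists>\<sigma>.
      bij_betw \<sigma> (I (Suc n)) (SIGMA E : \<E> n. {..<length (haar_block \<mu> E (sub n E))}) \<and>
      (\<forall>m\<in>I (Suc n). h m (Suc n) = (case \<sigma> m of (E, k) \<Rightarrow> haar_block \<mu> E (sub n E) ! k))"
    using assms(13) unfolding haar_basis_def by (elim conjE exE)
  \<comment> \<open>The definition provides a numbering for each level separately; choice gathers
    them into one function of the level, as the locale expects.\<close>
  obtain \<sigma> where \<sigma>: "\<forall>n.
      bij_betw (\<sigma> n) (I (Suc n)) (SIGMA E : \<E> n. {..<length (haar_block \<mu> E (sub n E))}) \<and>
      (\<forall>m\<in>I (Suc n). h m (Suc n) = (case \<sigma> n m of (E, k) \<Rightarrow> haar_block \<mu> E (sub n E) ! k))"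
    using choice[OF ex] by (elim exE)
  interpret finite_measure \<mu> by fact
  interpret haar_system \<mu> \<Omega> \<E> I h sub \<sigma>
  proof unfold_locales
    show "E \<in> sets \<mu>" if "E \<in> \<E> n" for n E
      unfolding sets using that by (intro sigma_sets.Basic) auto
    show "I 0 = {0}" "h 0 0 = (\<lambda>x. indicator \<Omega> x * measure \<mu> \<Omega> powr (- 1 / 2))"
      using assms(13) by (auto simp: haar_basis_def)
  qed (use assms sub \<sigma> in auto)
  have dense: "L2_space \<mu> \<subseteq> L2_closure \<mu> ?H"
  proof (rule L2_space_subset_closure[OF fun_space.subspace_span])
    show "Int_stable ?G" by (rule refines_seq_Int_stable) fact
    show "?G \<subseteq> Pow (space \<mu>)" using part by (auto simp: space partition_on_def)
    show "sets \<mu> = sigma_sets (space \<mu>) ?G" by (simp add: sets space)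
    \<comment> \<open>The empty set belongs to \<open>?G\<close> for intersection stability; its
      indicator is the zero function.\<close>
    show "indicator A \<in> ?H" if "A \<in> ?G" for A
    proof (cases "A = {}")
      case True
      then show ?thesis
        using subspace_fun_zero[OF fun_space.subspace_span] by (simp add: indicator_def[abs_def])
    next
      case False
      then show ?thesis using that cells_in_haar_span by blast
    qed
    show "indicator (space \<mu>) \<in> ?H"
      using cells_in_haar_span[of 0] E0 by (simp add: space)
  qed
  show ?thesis
    unfolding L2_complete_orthonormal_basis_def
  proof (intro conjI h_orthonormal ballI allI impI)
    fix f and \<epsilon> :: real
    assume "f \<in> L2_space \<mu>" and "\<epsilon> > 0"
    \<comment> \<open>The closure is expressed through squared norms, so the tolerance for it is the
      square of \<open>\<epsilon>\<close>.\<close>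
    then have "f \<in> L2_closure \<mu> ?H" and "\<epsilon>\<^sup>2 > 0"
      using dense by auto
    then obtain g where g: "g \<in> ?H" and d: "L2_inner \<mu> (\<lambda>x. f x - g x) (\<lambda>x. f x - g x) < \<epsilon>\<^sup>2"
      by (rule L2_closureD)
    obtain J c where J: "finite J" "J \<subseteq> {(m, n). m \<in> I n}"
      and gJ: "g = (\<lambda>x. \<Sum>i\<in>J. c i * (case i of (m, n) \<Rightarrow> h m n) x)"
      using g by (rule span_image_explicit)
    have "L2_norm \<mu> (\<lambda>x. f x - g x) < \<epsilon>"
      unfolding L2_norm_def using d \<open>\<epsilon> > 0\<close>
      by (intro real_less_lsqrt) (auto simp: L2_inner_self_nonneg)
    then show "\<exists>J c. finite J \<and> J \<subseteq> {(m, n). m \<in> I n} \<and>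
        L2_norm \<mu> (\<lambda>x. f x - (\<Sum>i\<in>J. c i * (case i of (m, n) \<Rightarrow> h m n) x)) < \<epsilon>"
      using J unfolding gJ by (intro exI[of _ J] exI[of _ c] conjI)
  qed
qed

end
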